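(* Let $p,q$ be positive integers with $p\geq q$ and $p\geq 2$, and let $\mathcal{L}$ denote the equation $px+qy=z$. Let $S$ be an $\mathcal{L}$-free subset of $[n]$, and let $\min(S)=\lfloor \frac{n}{p+q}\rfloor - t$ where $t$ is a non-negative integer. (i) If $0\leq t<\left(\frac{p+q-1}{p+q+p/q}\right)\lfloor \frac{n}{p+q}\rfloor$ then $|S|\leq \lceil \frac{(p+q-1)n}{p+q}\rceil-\lfloor \frac{p}{q}t\rfloor$. (ii) If $t\geq \left(\frac{p+q-1}{p+q+p/q}\right)\lfloor \frac{n}{p+q}\rfloor$ then $|S|\leq \frac{(q^2+1)n}{q^2+q+1}$ provided that $$n\geq \max\left\{\frac{3(q^2+q+1)(q^3+p(q^2+q+1))}{q^2+1},\ \frac{5(q^2+q+1)(q^5+p(q^4+q^3+q^2+q+1))}{q^4+(p-1)q^3+q^2+1}\right\}.$$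
   Context: $[n]=\{1,\dots,n\}$. A set $A\subseteq[n]$ is $\mathcal{L}$-free, for $\mathcal{L}$ the equation $px+qy=z$ with $p,q$ as in the statement, if there are no $x,y,z\in A$ (not necessarily distinct) with $px+qy=z$ (such an equation has no trivial solutions). $\min(S)$ denotes the smallest element of the nonempty finite set $S\subseteq\mathbb{N}$; $\mathbb{N}$ is the set of positive integers. *)

theory Defs
  imports Complex_Main
begin

definition solution_free :: "nat \<Rightarrow> nat \<Rightarrow> nat set \<Rightarrow> bool" where
  "solution_free p q A \<longleftrightarrow> \<not> (\<exists>x\<in>A. \<exists>y\<in>A. \<exists>z\<in>A. p * x + q * y = z)"

end

theory Submission imports Defs
begin

text \<open>Let \<open>m = Min S\<close> and \<open>f y = p * m + q * y\<close>. No \<open>y\<close> and \<open>f y\<close> lie both in \<open>S\<close>, so every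
  matching of the graph with edges \<open>y \<leadsto> f y\<close> on \<open>{m..n}\<close> bounds the number of missing elements
  from below. If \<open>m\<close> is large, the edges at the smallest vertices already give (i). If \<open>m\<close> is
  small, at least two iterates of \<open>f\<close> fit below \<open>n\<close>; let \<open>a\<^sub>i\<close> be the largest number whose \<open>i\<close>-th
  iterate is at most \<open>n\<close>. Matching \<open>(a\<^sub>2, a\<^sub>1]\<close> into \<open>(a\<^sub>1, n]\<close>, then \<open>(a\<^sub>4, a\<^sub>3]\<close> into \<open>(a\<^sub>3, a\<^sub>2]\<close>,
  gives (ii) for \<open>q \<ge> 2\<close>. For \<open>q = 1\<close> the intervals between the \<open>a\<^sub>i\<close> all have the same length, and
  arbitrarily many of them have to be used.\<close>

section \<open>Counting missing elements by matchings\<close>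

text \<open>Each \<open>y\<close> in \<open>{c<..a}\<close> yields a missing element:
  \<open>y\<close> itself or, if \<open>y\<close> lies in \<open>S\<close>, its image
  \<open>f y\<close>. The window puts all images above \<open>a\<close>, so these elements are
  distinct. They also lie above \<open>c\<close>, so the missing elements of \<open>{m..c}\<close>
  can be added, and the argument can be repeated with \<open>c\<close> as the new upper end.\<close>

lemma card_missing_step:
  fixes f :: "nat \<Rightarrow> nat"
  assumes "inj f" and free: "\<And>y. y \<in> S \<Longrightarrow> f y \<notin> S"
    and window: "\<And>y. c < y \<Longrightarrow> y \<le> a \<Longrightarrow> a < f y \<and> f y \<le> n"
    and "c \<le> a" and "a \<le> n" and "m \<le> Suc c"
  shows "a - c + card ({m..c} - S) \<le> card ({m..n} - S)"
proof -
  define h where "h y = (if y \<in> S then f y else y)" for y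
  have "inj_on h {c<..a}"
  proof (rule inj_onI)
    fix x y assume "x \<in> {c<..a}" "y \<in> {c<..a}" "h x = h y"
    then show "x = y"
      using window[of x] window[of y] injD[OF \<open>inj f\<close>, of x y] by (auto simp: h_def split: if_splits)
  qed
  then have "card (h ` {c<..a}) = a - c"
    by (simp add: card_image)
  moreover have "h ` {c<..a} \<subseteq> {c<..n} - S"
  proof (rule image_subsetI)
    fix x assume "x \<in> {c<..a}"
    then show "h x \<in> {c<..n} - S"
      using window[of x] free[of x] \<open>a \<le> n\<close> by (auto simp: h_def)
  qed
  then have "card (h ` {c<..a} \<union> ({m..c} - S)) = card (h ` {c<..a}) + card ({m..c} - S)"
    by (intro card_Un_disjoint) auto
  moreover have "h ` {c<..a} \<union> ({m..c} - S) \<subseteq> {m..n} - S"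
    using \<open>h ` {c<..a} \<subseteq> {c<..n} - S\<close> \<open>c \<le> a\<close> \<open>a \<le> n\<close> \<open>m \<le> Suc c\<close> by auto
  then have "card (h ` {c<..a} \<union> ({m..c} - S)) \<le> card ({m..n} - S)"
    by (intro card_mono) auto
  ultimately show ?thesis by simp
qed

text \<open>Serves the case \<open>q = 1\<close>, where \<open>f\<close> is translation by
  \<open>d = p * m\<close>. Any \<open>2 * d\<close> consecutive numbers contain at least
  \<open>d\<close> missing ones, so such blocks are peeled off the top. Asking for the ratio 1/3
  instead of 1/2 leaves room for the incomplete block at the bottom.\<close>

lemma card_missing_translation:
  fixes d m n :: nat
  assumes "0 < d" and "0 < m" and free: "\<And>y. y \<in> S \<Longrightarrow> d + y \<notin> S"
    and "m + 2 * d \<le> Suc n"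
  shows "Suc n \<le> m + 3 * card ({m..n} - S)"
  using assms(4)
proof (induction n rule: less_induct)
  case (less n)
  note step = card_missing_step[where f = "(+) d" and S = S and m = m, OF _ free]
  consider "m + 4 * d \<le> Suc n" | "m + 3 * d \<le> Suc n" "Suc n < m + 4 * d" | "Suc n < m + 3 * d"
    by linarith
  then show ?case
  proof cases
    case 1
    have "(n - d) - (n - 2 * d) + card ({m..n - 2 * d} - S) \<le> card ({m..n} - S)"
      using 1 \<open>0 < d\<close> by (intro step) auto
    moreover have "Suc (n - 2 * d) \<le> m + 3 * card ({m..n - 2 * d} - S)"
      using 1 \<open>0 < d\<close> by (intro less.IH) auto
    ultimately show ?thesis using 1 \<open>0 < d\<close> by linarith
  next
    \<comment> \<open>Let \<open>L = Suc n - m\<close>. The top block gives \<open>d\<close>, and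
      the remaining \<open>L - 2 * d\<close> numbers give \<open>L - 3 * d\<close>; the sum
      \<open>L - 2 * d\<close> is at least \<open>L / 3\<close> because
      \<open>3 * d \<le> L\<close>. The lower end \<open>m - 1\<close> makes the leftover set
      empty.\<close>
    case 2
    have "(n - d) - (n - 2 * d) + card ({m..n - 2 * d} - S) \<le> card ({m..n} - S)"
      using 2 \<open>0 < d\<close> by (intro step) auto
    moreover have "(n - 3 * d) - (m - 1) + card ({m..m - 1} - S) \<le> card ({m..n - 2 * d} - S)"
      using 2 \<open>0 < d\<close> \<open>0 < m\<close> by (intro step) auto
    ultimately show ?thesis using 2 \<open>0 < m\<close> by linarith
  next
    \<comment> \<open>Matching the lowest \<open>d\<close> numbers suffices, as fewer than
      \<open>3 * d\<close> numbers are present.\<close>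
    case 3
    have "(m - 1 + d) - (m - 1) + card ({m..m - 1} - S) \<le> card ({m..n} - S)"
      using 3 less.prems \<open>0 < d\<close> \<open>0 < m\<close> by (intro step) auto
    then show ?thesis using 3 by linarith
  qed
qed

section \<open>Real inequalities for two, three and four levels\<close>

text \<open>Only the linear inequalities between neighbouring levels are kept; the extra
  \<open>q\<close> accounts for rounding down. The condition on \<open>n\<close> is the first entry
  of the maximum in (ii), cleared of its denominator. \<open>G\<close> stands for a lower bound on
  the size of the complement of \<open>S\<close> in \<open>{1..n}\<close>.\<close>

context
  fixes p q m n a1 a2 :: real
  assumes pq: "1 \<le> q" "q \<le> p" and m: "1 \<le> m"
    and n: "3 * (q^2 + q + 1) * (q^3 + p * (q^2 + q + 1)) \<le> (q^2 + 1) * n"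
    and a1: "n \<le> p * m + q * a1 + q" and a2: "p * m + q * a2 \<le> a1"
begin

text \<open>The first assumption says that the third iterate of \<open>m\<close> is at least
  \<open>n\<close>. Together with the size of \<open>n\<close> it forces \<open>m\<close> to be
  large, and the \<open>m - 1\<close> numbers below \<open>m\<close> make up for the coarse
  matching.\<close>

lemma two_levels_bound:
  assumes "n \<le> (q^3 + p * (q^2 + q + 1)) * m" and "m - 1 + a1 - a2 \<le> G"
  shows "q * n \<le> (q^2 + q + 1) * G"
proof -
  define C where "C = q^3 + p * (q^2 + q + 1)"
  define D where "D = q^2 + q + 1"
  have pos: "0 < C" "0 < D" using pq by (auto simp: C_def D_def intro!: add_pos_pos mult_pos_pos)
  have "(3 * D) * C \<le> ((q^2 + 1) * m) * C"
    using n mult_left_mono[OF assms(1), of "q^2 + 1"] by (simp add: C_def D_def algebra_simps)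
  then have m3: "3 * D \<le> (q^2 + 1) * m" using pos by simp
  \<comment> \<open>The term \<open>q^2 * a1\<close> is split as
    \<open>(q - 1) * q * a1 + q * a1\<close>: the first part is compared with \<open>n\<close>, the
    second with \<open>a2\<close>.\<close>
  have "(q - 1) * (n - p*m - q) \<le> (q - 1) * (q * a1)"
    using pq a1 by (intro mult_left_mono) auto
  moreover have "q * (p * m + q * a2) \<le> q * a1"
    using pq a2 by (intro mult_left_mono) auto
  ultimately have "(q - 1) * n + (p + q^2) * m - 2 * q^2 + q \<le> q^2 * (m - 1 + a1 - a2)"
    by (simp add: algebra_simps power2_eq_square)
  also have "\<dots> \<le> q^2 * G" using assms(2) by (intro mult_left_mono) auto
  finally have "D * ((q - 1) * n + (p + q^2) * m - 2 * q^2 + q) \<le> D * (q^2 * G)"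
    using pos by (intro mult_left_mono) auto
  moreover have "q^3 * n \<le> D * ((q - 1) * n + (p + q^2) * m - 2 * q^2 + q)"
  proof -
    have "D * ((q - 1) * n + (p + q^2) * m - 2 * q^2 + q)
        = q^3 * n + (C * m - n) + q^2 * ((q^2 + 1) * m - 3 * D) + q^2 * D + q * D"
      unfolding C_def D_def by algebra
    moreover have "0 \<le> q^2 * ((q^2 + 1) * m - 3 * D)" using m3 by simp
    moreover have "0 \<le> q^2 * D" "0 \<le> q * D" using pos pq by auto
    ultimately show ?thesis using assms(1) by (simp add: C_def)
  qed
  ultimately have "q^2 * (q * n) \<le> q^2 * (D * G)"
    by (simp add: algebra_simps power2_eq_square power3_eq_cube)
  then show ?thesis using pq by (simp add: D_def)
qed

text \<open>Here \<open>m\<close> is small against \<open>n\<close>. The third level is matched from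
  \<open>m\<close> upwards, giving \<open>a3 - (m - 1)\<close> missing elements, and the
  \<open>m - 1\<close> numbers below \<open>m\<close> cancel the subtraction.\<close>

lemma three_levels_bound:
  assumes "(q^3 + p * (q^2 + q + 1)) * m \<le> n" and a3: "a2 \<le> p * m + q * a3 + q"
    and "a1 - a2 + a3 \<le> G"
  shows "q * n \<le> (q^2 + q + 1) * G"
proof -
  define C where "C = q^3 + p * (q^2 + q + 1)"
  define D where "D = q^2 + q + 1"
  have pos: "0 < C" "0 < D" using pq by (auto simp: C_def D_def intro!: add_pos_pos mult_pos_pos)
  \<comment> \<open>Since \<open>C = q^3 + p * D\<close>, the bound \<open>C * m \<le> n\<close>
    gives \<open>C * (n - D * p * m) \<ge> q^3 * n\<close>.\<close>
  have "(D * (3 * q^3)) * C \<le> ((q^2 + 1) * (n - D * p * m)) * C"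
  proof -
    have "q^3 * (3 * D * C) \<le> q^3 * ((q^2 + 1) * n)"
      using n pq by (intro mult_left_mono) (auto simp: C_def D_def)
    moreover have "(q^2 + 1) * D * p * (C * m) \<le> (q^2 + 1) * D * p * n"
      using assms(1) pq pos by (intro mult_left_mono) (auto simp: C_def)
    ultimately show ?thesis by (simp add: C_def D_def algebra_simps)
  qed
  then have key: "D * (3 * q^3) \<le> (q^2 + 1) * (n - D * p * m)" using pos by simp
  have q1: "0 \<le> q^2 - q + 1" using pq self_le_power[of q 2] by simp
  have "(q^2 - q + 1) * (n - p*m - q) \<le> (q^2 - q + 1) * (q * a1)"
    using a1 q1 by (intro mult_left_mono) auto
  moreover have "q * (q - 1) * (p * m + q * a2) \<le> q * (q - 1) * a1"
    using pq a2 by (intro mult_left_mono) auto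
  moreover have "q^2 * a2 \<le> q^2 * (p * m + q * a3 + q)"
    using a3 by (intro mult_left_mono) auto
  moreover have "q^3 * (a1 - a2 + a3) - ((q^2 - q + 1) * n - (q^2 + 1) * p * m - q * (q^2 - q + 1) - q^3)
      = ((q^2 - q + 1) * (q * a1) - (q^2 - q + 1) * (n - p*m - q))
        + (q * (q - 1) * a1 - q * (q - 1) * (p * m + q * a2))
        + (q^2 * (p * m + q * a3 + q) - q^2 * a2)"
    by algebra
  ultimately have "(q^2 - q + 1) * n - (q^2 + 1) * p * m - q * (q^2 - q + 1) - q^3
      \<le> q^3 * (a1 - a2 + a3)"
    by linarith
  also have "\<dots> \<le> q^3 * G" using assms(3) pq by (intro mult_left_mono) auto
  finally have "D * ((q^2 - q + 1) * n - (q^2 + 1) * p * m - q * (q^2 - q + 1) - q^3) \<le> D * (q^3 * G)"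
    using pos by (intro mult_left_mono) auto
  moreover have "q^4 * n \<le> D * ((q^2 - q + 1) * n - (q^2 + 1) * p * m - q * (q^2 - q + 1) - q^3)"
  proof -
    have "D * ((q^2 - q + 1) * n - (q^2 + 1) * p * m - q * (q^2 - q + 1) - q^3)
        = q^4 * n + ((q^2 + 1) * (n - D * p * m) - D * (3 * q^3)) + D * (q^3 + q * (q - 1))"
      unfolding D_def by algebra
    moreover have "0 \<le> D * (q^3 + q * (q - 1))" using pos pq by auto
    ultimately show ?thesis using key by linarith
  qed
  ultimately have "q^3 * (q * n) \<le> q^3 * (D * G)"
    by (simp add: algebra_simps eval_nat_numeral)
  then show ?thesis using pq by (simp add: D_def)
qed

text \<open>Up to lower order terms the four levels give
  \<open>(q - 1) * (q^2 + 1) * n / q^4\<close>. Multiplied by \<open>q^4 * D\<close>, this exceeds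
  the target \<open>q^5 * n\<close> by \<open>(q^3 - q^2 - 1) * n\<close>, which is positive for
  \<open>q \<ge> 2\<close> but negative for \<open>q = 1\<close>.\<close>

lemma four_levels_bound:
  assumes "2 \<le> q" and a3: "a2 \<le> p * m + q * a3 + q" and a4: "p * m + q * a4 \<le> a3"
    and "a1 - a2 + a3 - a4 \<le> G"
  shows "q * n \<le> (q^2 + q + 1) * G"
proof -
  define D where "D = q^2 + q + 1"
  have pos: "0 < D" using pq by (auto simp: D_def intro!: add_pos_pos)
  \<comment> \<open>This multiple of \<open>q * D\<close> is large enough for the surplus in
    \<open>n\<close> to absorb the rounding errors.\<close>
  have n6: "6 * q * D \<le> n"
  proof -
    have "2 * q * (q^2 + 1) \<le> q^3 + q * (q^2 + q + 1)"
      using mult_right_mono[OF pq(1), of q] pq by (simp add: algebra_simps eval_nat_numeral)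
    also have "\<dots> \<le> q^3 + p * (q^2 + q + 1)"
      using pq pos by (simp add: D_def mult_right_mono)
    finally have "3 * D * (2 * q * (q^2 + 1)) \<le> 3 * D * (q^3 + p * (q^2 + q + 1))"
      using pos by (intro mult_left_mono) auto
    then have "(q^2 + 1) * (6 * q * D) \<le> (q^2 + 1) * n"
      using n by (simp add: D_def algebra_simps)
    moreover have "0 < q^2 + 1" by (simp add: add_nonneg_pos)
    ultimately show ?thesis by (simp only: mult_le_cancel_left_pos)
  qed
  have q1: "0 \<le> q^2 - q + 1" using pq self_le_power[of q 2] by simp
  have "(q - 1) * (q^2 + 1) * (n - p*m - q) \<le> (q - 1) * (q^2 + 1) * (q * a1)"
    using a1 pq by (intro mult_left_mono) auto
  moreover have "q * (q^2 - q + 1) * (p * m + q * a2) \<le> q * (q^2 - q + 1) * a1"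
    using pq q1 a2 by (intro mult_left_mono) auto
  moreover have "q^2 * (q - 1) * a2 \<le> q^2 * (q - 1) * (p * m + q * a3 + q)"
    using a3 pq by (intro mult_left_mono) auto
  moreover have "q^3 * (p * m + q * a4) \<le> q^3 * a3"
    using a4 pq by (intro mult_left_mono) auto
  moreover have "0 \<le> (q^2 + 1) * (p * m)"
    using pq m by auto
  moreover have "q^4 * (a1 - a2 + a3 - a4) - ((q - 1) * (q^2 + 1) * n - q * (q - 1) * (2 * q^2 + 1))
      = ((q - 1) * (q^2 + 1) * (q * a1) - (q - 1) * (q^2 + 1) * (n - p*m - q))
        + (q * (q^2 - q + 1) * a1 - q * (q^2 - q + 1) * (p * m + q * a2))
        + (q^2 * (q - 1) * (p * m + q * a3 + q) - q^2 * (q - 1) * a2)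
        + (q^3 * a3 - q^3 * (p * m + q * a4)) + (q^2 + 1) * (p * m)"
    by algebra
  ultimately have "(q - 1) * (q^2 + 1) * n - q * (q - 1) * (2 * q^2 + 1)
      \<le> q^4 * (a1 - a2 + a3 - a4)"
    by linarith
  also have "\<dots> \<le> q^4 * G" using assms(4) pq by (intro mult_left_mono) auto
  finally have "D * ((q - 1) * (q^2 + 1) * n - q * (q - 1) * (2 * q^2 + 1)) \<le> D * (q^4 * G)"
    using pos by (intro mult_left_mono) auto
  moreover have "q^5 * n \<le> D * ((q - 1) * (q^2 + 1) * n - q * (q - 1) * (2 * q^2 + 1))"
  proof -
    have "0 \<le> (q - 2) * q^2" "0 \<le> (q - 2) * q" using \<open>2 \<le> q\<close> by auto
    moreover have "4 * q^3 - 4 * q^2 - q - 5 = 4 * ((q - 2) * q^2) + 4 * ((q - 2) * q) + 7 * q - 5"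
      and "q^3 - q^2 - 1 = (q - 2) * q^2 + (q - 2) * q + 2 * q - 1"
      by algebra+
    ultimately have q3: "0 \<le> 4 * q^3 - 4 * q^2 - q - 5" "0 \<le> q^3 - q^2 - 1"
      using \<open>2 \<le> q\<close> by linarith+
    have "D * ((q - 1) * (q^2 + 1) * n - q * (q - 1) * (2 * q^2 + 1))
        = q^5 * n + (q^3 - q^2 - 1) * (n - 6 * q * D) + q * D * (4 * q^3 - 4 * q^2 - q - 5)"
      unfolding D_def by algebra
    moreover have "0 \<le> (q^3 - q^2 - 1) * (n - 6 * q * D)" using q3 n6 by simp
    moreover have "0 \<le> q * D * (4 * q^3 - 4 * q^2 - q - 5)" using q3 pq pos by simp
    ultimately show ?thesis by linarith
  qed
  ultimately have "q^4 * (q * n) \<le> q^4 * (D * G)"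
    by (simp add: algebra_simps eval_nat_numeral)
  then show ?thesis using pq by (simp add: D_def)
qed

end

section \<open>The counting bound for a small minimum\<close>

text \<open>For \<open>m = Min S\<close> the last factor is \<open>n - card S\<close>, as the
  \<open>m - 1\<close> numbers below \<open>m\<close> are missing too. The cases for
  \<open>q \<ge> 2\<close> depend on how many iterates of \<open>m\<close> under \<open>f\<close>
  stay at most \<open>n\<close>; \<open>small\<close> guarantees two.\<close>

lemma card_missing_small_min:
  fixes p q m n :: nat
  assumes "0 < q" and "q \<le> p" and "0 < m" and free: "\<And>y. y \<in> S \<Longrightarrow> p * m + q * y \<notin> S"
    and small: "p * m + q * (p * m + q * m) \<le> n"
    and large: "3 * (real q ^ 2 + real q + 1) * (real q ^ 3 + real p * (real q ^ 2 + real q + 1))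
                \<le> (real q ^ 2 + 1) * real n"
  shows "real q * real n \<le> (real q ^ 2 + real q + 1) * (real m - 1 + real (card ({m..n} - S)))"
proof (cases "q = 1")
  case True
  have "Suc n \<le> m + 3 * card ({m..n} - S)"
    using assms True by (intro card_missing_translation[of "p * m"]) auto
  then have "real n + 1 \<le> real m + 3 * real (card ({m..n} - S))" by linarith
  moreover have "1 \<le> real m" using \<open>0 < m\<close> by simp
  ultimately show ?thesis using True by (simp add: power2_eq_square)
next
  case False
  define f where "f y = p * m + q * y" for y
  \<comment> \<open>Rounded inverse of \<open>f\<close>: once \<open>f m \<le> x\<close>, the
    truncated subtraction is exact and \<open>g x\<close> is the largest number that
    \<open>f\<close> maps to at most \<open>x\<close>.\<close>
  define g where "g x = (x - p * m) div q" for x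
  have "inj f" using \<open>0 < q\<close> by (auto simp: f_def inj_def)
  have mono: "f x \<le> f y \<longleftrightarrow> x \<le> y" for x y
    using \<open>0 < q\<close> by (simp add: f_def)
  have le_f: "y \<le> f y" for y
    using \<open>0 < q\<close> mult_le_mono1[of 1 q y] by (simp add: f_def trans_le_add2)
  have le_g: "y \<le> g x \<longleftrightarrow> f y \<le> x" if "f m \<le> x" for x y
  proof -
    have "p * m \<le> x" using that by (simp add: f_def)
    then show ?thesis using \<open>0 < q\<close>
      by (auto simp: f_def g_def less_eq_div_iff_mult_less_eq algebra_simps)
  qed
  have f_g: "f (g x) \<le> x" and less_f_Suc_g: "x < f (Suc (g x))" if "f m \<le> x" for x
    using le_g[OF that, of "g x"] le_g[OF that, of "Suc (g x)"] by auto
  have lower: "real p * real m + real q * real (g x) \<le> real x"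
    and upper: "real x \<le> real p * real m + real q * real (g x) + real q" if "f m \<le> x" for x
    using f_g[OF that] less_f_Suc_g[OF that]
    by (simp_all add: f_def algebra_simps flip: of_nat_mult of_nat_add)
  have step: "g x - c + card ({m..c} - S) \<le> card ({m..x} - S)"
    if "f m \<le> x" "m \<le> Suc c" "c \<le> g x" "g x < f (Suc c)" for x c
  proof (rule card_missing_step[where f = f, OF \<open>inj f\<close>])
    show "f y \<notin> S" if "y \<in> S" for y
      using free[OF that] by (simp add: f_def)
    show "g x < f y \<and> f y \<le> x" if "c < y" "y \<le> g x" for y
      using that le_g[OF \<open>f m \<le> x\<close>] mono[of "Suc c" y] \<open>g x < f (Suc c)\<close> by auto
    show "g x \<le> x"
      using f_g[OF \<open>f m \<le> x\<close>] le_f order.trans by blast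
  qed fact+
  define a1 where "a1 = g n"
  define a2 where "a2 = g a1"
  define G where "G = card ({m..n} - S)"
  have "f (f m) \<le> n" using small by (simp add: f_def)
  then have n: "f m \<le> n" using le_f[of "f m"] by linarith
  then have a1: "f m \<le> a1" using \<open>f (f m) \<le> n\<close> by (simp add: a1_def le_g)
  then have a2: "m \<le> a2"
    by (simp add: a2_def le_g)
  have "a2 \<le> a1"
    using f_g[OF a1] le_f[of a2] by (simp add: a2_def)
  then have levels12: "a1 - a2 + card ({m..a2} - S) \<le> G"
    using step[OF n, of a2] a2 less_f_Suc_g[OF a1] by (simp add: a1_def a2_def G_def)
  have third: "f m \<le> a2 \<longleftrightarrow> f (f (f m)) \<le> n"
    using le_g[OF a1, of "f m"] le_g[OF n, of "f (f m)"] by (simp add: a1_def a2_def)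
  have fff: "real (f (f (f m))) = (real q ^ 3 + real p * (real q ^ 2 + real q + 1)) * real m"
    by (simp add: f_def algebra_simps eval_nat_numeral)
  have pq: "1 \<le> real q" "real q \<le> real p" "1 \<le> real m"
    using assms by auto
  show ?thesis
    unfolding G_def[symmetric]
  proof (cases "f m \<le> a2")
    case no_third: False
    show "real q * real n \<le> (real q ^ 2 + real q + 1) * (real m - 1 + real G)"
    proof (rule two_levels_bound[OF pq large])
      show "real n \<le> real p * real m + real q * real a1 + real q" "real p * real m + real q * real a2 \<le> real a1"
        using upper[OF n] lower[OF a1] by (simp_all add: a1_def a2_def)
      show "real n \<le> (real q ^ 3 + real p * (real q ^ 2 + real q + 1)) * real m"
        using no_third third unfolding fff[symmetric] by simp
      show "real m - 1 + real a1 - real a2 \<le> real m - 1 + real G"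
        using levels12 \<open>a2 \<le> a1\<close> by simp
    qed
  next
    case True
    define a3 where "a3 = g a2"
    have a3: "m \<le> a3" using True by (simp add: a3_def le_g)
    show "real q * real n \<le> (real q ^ 2 + real q + 1) * (real m - 1 + real G)"
    proof (cases "f m \<le> a3")
      case no_fourth: False
      \<comment> \<open>As \<open>a3 < f m\<close>, everything from \<open>m\<close> to
        \<open>a3\<close> is mapped beyond \<open>a3\<close>, so the whole interval can be
        matched.\<close>
      have "a3 - (m - 1) \<le> card ({m..a2} - S)"
        using step[OF True, of "m - 1"] a3 no_fourth \<open>0 < m\<close> by (simp add: a3_def)
      then have G: "real a1 - real a2 + real a3 \<le> real m - 1 + real G"
        using levels12 \<open>a2 \<le> a1\<close> a3 \<open>0 < m\<close> by linarith
      show ?thesis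
      proof (rule three_levels_bound[OF pq large _ _ _ _ G])
        show "real n \<le> real p * real m + real q * real a1 + real q" "real p * real m + real q * real a2 \<le> real a1"
          and "real a2 \<le> real p * real m + real q * real a3 + real q"
          using upper[OF n] lower[OF a1] upper[OF True] by (simp_all add: a1_def a2_def a3_def)
        show "(real q ^ 3 + real p * (real q ^ 2 + real q + 1)) * real m \<le> real n"
          using True third unfolding fff[symmetric] by simp
      qed
    next
      case four: True
      define a4 where "a4 = g a3"
      have "m \<le> a4" using four by (simp add: a4_def le_g)
      have "a4 \<le> a3" using f_g[OF four] le_f[of a4] by (simp add: a4_def)
      then have "a3 - a4 \<le> card ({m..a2} - S)"
        using step[OF True, of a4] \<open>m \<le> a4\<close> less_f_Suc_g[OF four] by (simp add: a3_def a4_def)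
      then have G: "real a1 - real a2 + real a3 - real a4 \<le> real m - 1 + real G"
        using levels12 \<open>a2 \<le> a1\<close> \<open>a4 \<le> a3\<close> \<open>0 < m\<close> by linarith
      show ?thesis
      proof (rule four_levels_bound[OF pq large _ _ _ _ _ G])
        show "real n \<le> real p * real m + real q * real a1 + real q" "real p * real m + real q * real a2 \<le> real a1"
          and "real a2 \<le> real p * real m + real q * real a3 + real q" "real p * real m + real q * real a4 \<le> real a3"
          using upper[OF n] lower[OF a1] upper[OF True] lower[OF four]
          by (simp_all add: a1_def a2_def a3_def a4_def)
        show "2 \<le> real q" using False \<open>0 < q\<close> by simp
      qed
    qed
  qed
qed

section \<open>The two regimes of the minimum\<close>

theorem theorem1:
  fixes p q n t :: nat and S :: "nat set"
  assumes "0 < q" and "q \<le> p" and "2 \<le> p"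
    and "S \<subseteq> {1..n}" and "S \<noteq> {}"
    and "solution_free p q S"
    and "int (Min S) = \<lfloor>real n / real (p + q)\<rfloor> - int t"
  shows "(real t < (real p + real q - 1) / (real p + real q + real p / real q)
              * of_int \<lfloor>real n / real (p + q)\<rfloor> \<longrightarrow>
            int (card S) \<le> \<lceil>(real p + real q - 1) * real n / (real p + real q)\<rceil>
              - \<lfloor>real p / real q * real t\<rfloor>) \<and>
         (real t \<ge> (real p + real q - 1) / (real p + real q + real p / real q)
              * of_int \<lfloor>real n / real (p + q)\<rfloor> \<longrightarrow>
            real n \<ge> max
              (3 * (real q ^ 2 + real q + 1) * (real q ^ 3 + real p * (real q ^ 2 + real q + 1))
                / (real q ^ 2 + 1))
              (5 * (real q ^ 2 + real q + 1)
                 * (real q ^ 5 + real p * (real q ^ 4 + real q ^ 3 + real q ^ 2 + real q + 1))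
                / (real q ^ 4 + (real p - 1) * real q ^ 3 + real q ^ 2 + 1)) \<longrightarrow>
            real (card S) \<le> (real q ^ 2 + 1) * real n / (real q ^ 2 + real q + 1))"
proof -
  define m where "m = Min S"
  define M where "M = n div (p + q)"
  define G where "G = card ({m..n} - S)"
  have "finite S" using \<open>S \<subseteq> {1..n}\<close> finite_subset by blast
  then have "m \<in> S" and "S \<subseteq> {m..n}"
    using \<open>S \<noteq> {}\<close> \<open>S \<subseteq> {1..n}\<close> by (auto simp: m_def)
  then have "0 < m" "m \<le> n" using \<open>S \<subseteq> {1..n}\<close> by auto
  have floor_M: "\<lfloor>real n / real (p + q)\<rfloor> = int M"
    unfolding M_def by (rule floor_divide_of_nat_eq)
  then have mt: "M = m + t" using assms(7) by (simp add: m_def)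
  have Mn: "(p + q) * M \<le> n" by (simp add: M_def)
  have free: "p * m + q * y \<notin> S" if "y \<in> S" for y
    using assms(6) \<open>m \<in> S\<close> that by (auto simp: solution_free_def)
  have "card S + G = Suc n - m"
    using card_Int_Diff[of "{m..n}" S] \<open>S \<subseteq> {m..n}\<close> by (simp add: G_def Int_absorb1)
  then have card_S: "card S + G + m = n + 1" using \<open>m \<le> n\<close> by simp
  have pos: "0 < real p + real q + real p / real q" "0 < real q"
    using \<open>0 < q\<close> \<open>q \<le> p\<close> by (auto intro!: add_pos_nonneg)
  \<comment> \<open>Substituting \<open>M = m + t\<close> turns the fraction into a comparison of
    \<open>(p + q) * M\<close> with the second iterate of \<open>m\<close>.\<close>
  have threshold: "real t < (real p + real q - 1) / (real p + real q + real p / real q) * of_int \<lfloor>real n / real (p + q)\<rfloor>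
    \<longleftrightarrow> (p + q) * M < p * m + q * (p * m + q * m)" (is "?small \<longleftrightarrow> _")
  proof -
    have "?small \<longleftrightarrow> real t * (real p + real q + real p / real q) < (real p + real q - 1) * real M"
      using pos(1) unfolding floor_M by (simp add: field_simps)
    also have "\<dots> \<longleftrightarrow> real q * (real t * (real p + real q + real p / real q)) < real q * ((real p + real q - 1) * real M)"
      using pos(2) by (simp only: mult_less_cancel_left_pos)
    also have "\<dots> \<longleftrightarrow> real ((p + q) * M) < real (p * m + q * (p * m + q * m))"
      using pos(2) by (simp add: mt algebra_simps)
    finally show ?thesis by (simp only: of_nat_less_iff)
  qed
  show ?thesis
  proof (intro conjI impI)
    assume ?small
    then have large_min: "(p + q) * M < p * m + q * (p * m + q * m)" using threshold by simp
    \<comment> \<open>The largest \<open>y\<close> with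
      \<open>p * m + q * y \<le> (p + q) * M\<close>. As the second iterate of \<open>m\<close>
      exceeds \<open>(p + q) * M\<close>, \<open>a\<close> lies below the first iterate, so all of
      \<open>{m..a}\<close> can be matched into the numbers above \<open>a\<close>.\<close>
    define a where "a = M + p * t div q"
    have qa: "q * a \<le> q * M + p * t" by (simp add: a_def distrib_left)
    have "p * m + q * a \<le> (p + q) * M"
      using qa by (simp add: mt algebra_simps)
    then have fa: "p * m + q * a \<le> n" and "q * a < q * (p * m + q * m)"
      using Mn large_min by linarith+
    then have am: "a < p * m + q * m" by simp
    have "a - (m - 1) + card ({m..m - 1} - S) \<le> card ({m..n} - S)"
    proof (rule card_missing_step[where f = "\<lambda>y. p * m + q * y"])
      show "inj (\<lambda>y. p * m + q * y)" using \<open>0 < q\<close> by (auto simp: inj_def)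
      show "a < p * m + q * y \<and> p * m + q * y \<le> n" if "m - 1 < y" "y \<le> a" for y
      proof -
        have "q * m \<le> q * y" "q * y \<le> q * a" using that by (auto intro: mult_le_mono2)
        then show ?thesis using am fa by linarith
      qed
      have "a \<le> q * a" using \<open>0 < q\<close> by simp
      then show "a \<le> n" using fa by linarith
    qed (use free mt a_def in auto)
    then have "card S + a \<le> n"
      using card_S \<open>0 < m\<close> by (simp add: G_def)
    moreover have "\<lfloor>real p / real q * real t\<rfloor> = int (p * t div q)"
      using floor_divide_of_nat_eq[of "p * t" q] by simp
    moreover have "\<lceil>(real p + real q - 1) * real n / (real p + real q)\<rceil> = int n - int M"
    proof -
      have "(real p + real q - 1) * real n / (real p + real q) = of_int (int n) - real n / real (p + q)"
        using \<open>0 < q\<close> by (simp add: field_simps)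
      then show ?thesis
        using floor_M floor_diff_of_int[of "real n / real (p + q)" "int n"] by (simp add: ceiling_def)
    qed
    ultimately show "int (card S) \<le> \<lceil>(real p + real q - 1) * real n / (real p + real q)\<rceil> - \<lfloor>real p / real q * real t\<rfloor>"
      by (simp add: a_def)
  next
    let ?C = "real q ^ 3 + real p * (real q ^ 2 + real q + 1)"
    assume "(real p + real q - 1) / (real p + real q + real p / real q) * of_int \<lfloor>real n / real (p + q)\<rfloor> \<le> real t"
    then have "\<not> ?small" by (simp only: not_less)
    then have small: "p * m + q * (p * m + q * m) \<le> n" using threshold Mn by linarith
    assume "max (3 * (real q ^ 2 + real q + 1) * ?C / (real q ^ 2 + 1)) (5 * (real q ^ 2 + real q + 1)
                 * (real q ^ 5 + real p * (real q ^ 4 + real q ^ 3 + real q ^ 2 + real q + 1))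
                / (real q ^ 4 + (real p - 1) * real q ^ 3 + real q ^ 2 + 1)) \<le> real n"
    then have "3 * (real q ^ 2 + real q + 1) * ?C / (real q ^ 2 + 1) \<le> real n" by simp
    moreover have "0 < real q ^ 2 + 1" by (simp add: add_nonneg_pos)
    ultimately have "3 * (real q ^ 2 + real q + 1) * ?C \<le> (real q ^ 2 + 1) * real n"
      by (simp only: pos_divide_le_eq mult.commute)
    then have "real q * real n \<le> (real q ^ 2 + real q + 1) * (real m - 1 + real G)"
      unfolding G_def
      by (intro card_missing_small_min[OF \<open>0 < q\<close> \<open>q \<le> p\<close> \<open>0 < m\<close> free small])
    also have "real m - 1 + real G = real n - real (card S)" using card_S by linarith
    finally have "(real q ^ 2 + real q + 1) * real (card S) \<le> (real q ^ 2 + 1) * real n"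
      by (simp add: algebra_simps)
    moreover have "0 < real q ^ 2 + real q + 1" by (simp add: add_nonneg_pos)
    ultimately show "real (card S) \<le> (real q ^ 2 + 1) * real n / (real q ^ 2 + real q + 1)"
      by (simp only: pos_le_divide_eq mult.commute)
  qed
qed

end
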